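(* Let $M(S)$ be a matroid on a set $S$ with rank function $\rho$. Let $u$ and $v$ be words of length $p$ and $q$ on $S$, associated to independent subsets $A$ and $B$ of $S$, respectively (that is, the letters of $u$ are the distinct elements of $A$, and the letters of $v$ are the distinct elements of $B$). Let $k$ be the nonnegative integer such that $\rho(A\cup B)+k=p+q$. Then in the algebra $\mathcal{W}^2(M)$ we have $$\sum_{(v)_{(q-k,k)}}(uv_{(1)}|1^{(p+q-k)})\,(v_{(2)}|2^{(k)})=(-1)^{pq+k}\sum_{(u)_{(p-k,k)}}(vu_{(1)}|1^{(p+q-k)})\,(u_{(2)}|2^{(k)}).$$
   Context: Letterplace algebra: $\mathrm{Skew}[S|\underline{2}]$ is the free associative skew-symmetric unital $\mathbb{Z}$-algebra generated by the symbols $(x|i)$, $x\in S$, $i\in\{1,2\}$, i.e. the exterior algebra of the free $\mathbb{Z}$-module on these symbols (generators anticommute and square to zero). For a word $w=x_1\cdots x_r$ on $S$ and nonnegative integers $r_1+r_2=r$, sums over slices are $$\sum_{(w)_{(r_1,r_2)}}f(w_{(1)},w_{(2)})=\sum_{I}\operatorname{sgn}(I,J)\,f(x_I,x_J),$$ where $I$ runs over the $r_1$-subsets of $\{1,\dots,r\}$, $J$ is its complement, $x_I,x_J$ are the subwords with letters in increasing order of index, and $\operatorname{sgn}(I,J)$ is the sign of the permutation listing $I$ increasingly then $J$ increasingly. Biproducts: $(y_1\cdots y_r|i^{(r)})=(y_1|i)(y_2|i)\cdots(y_r|i)$ (equal to $1$ if $r=0$), and for $|w|=r_1+r_2$, $(w|1^{(r_1)}2^{(r_2)})=\sum_{(w)_{(r_1,r_2)}}(w_{(1)}|1^{(r_1)})(w_{(2)}|2^{(r_2)})$.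 $\mathcal{W}^2(M)=\mathrm{Skew}[S|\underline{2}]/J(M)$ (the letterplace encoding of the second Whitney algebra of $M$), where $J(M)$ is the bilateral ideal generated by all biproducts $(w|1^{(r_1)}2^{(r_2)})$, for all words $w=x_1\cdots x_r$ whose corresponding set $\{x_1,\dots,x_r\}$ is dependent in $M$ and all $r_1,r_2\ge0$ with $r_1+r_2=r$. The displayed identity is between classes in this quotient. *)

theory Defs
  imports "HOL-Combinatorics.Permutations" "HOL-Algebra.QuotRing"
begin

section \<open>Matroids\<close>

text \<open>
  The ground set is not required to be finite. For a finite ground set the axiom \<open>finitary\<close>
  holds trivially and the axioms are the usual ones for independent sets.
\<close>

locale matroid =
  fixes S :: "'a set" and indep :: "'a set \<Rightarrow> bool"
  assumes indep_carrier: "indep X \<Longrightarrow> X \<subseteq> S"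
    and indep_empty: "indep {}"
    and indep_subset: "indep X \<Longrightarrow> Y \<subseteq> X \<Longrightarrow> indep Y"
    and augment: "indep X \<Longrightarrow> indep Y \<Longrightarrow> finite X \<Longrightarrow> finite Y \<Longrightarrow> card Y < card X \<Longrightarrow>
      \<exists>x\<in>X - Y. indep (insert x Y)"
    and finitary: "X \<subseteq> S \<Longrightarrow> (\<And>Y. Y \<subseteq> X \<Longrightarrow> finite Y \<Longrightarrow> indep Y) \<Longrightarrow> indep X"

text \<open>Only meaningful for finite \<open>X\<close>; it is applied to finite sets only.\<close>

definition matroid_rank :: "('a set \<Rightarrow> bool) \<Rightarrow> 'a set \<Rightarrow> nat" where
  "matroid_rank indep X = Max {card I | I. I \<subseteq> X \<and> indep I}"


section \<open>The free associative algebra\<close>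

text \<open>
  Elements are finitely supported integer functions on the words over \<open>X\<close>; the product is
  convolution with respect to concatenation.
\<close>

definition free_algebra :: "'x set \<Rightarrow> ('x list \<Rightarrow> int) ring" where
  "free_algebra X =
    \<lparr>carrier = {f. finite {w. f w \<noteq> 0} \<and> {w. f w \<noteq> 0} \<subseteq> lists X},
     mult = (\<lambda>f g w. \<Sum>(x, y) | x @ y = w. f x * g y),
     one = (\<lambda>w. if w = [] then 1 else 0),
     zero = (\<lambda>w. 0),
     add = (\<lambda>f g w. f w + g w)\<rparr>"

definition free_gen :: "'x \<Rightarrow> 'x list \<Rightarrow> int" where
  "free_gen a = (\<lambda>w. if w = [a] then 1 else 0)"

lemma finite_splits: "finite {(x, y). x @ y = (w :: 'x list)}"
proof (rule finite_subset)
  show "{(x, y). x @ y = w} \<subseteq> (\<lambda>i. (take i w, drop i w)) ` {..length w}"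
  proof (clarify)
    fix x y assume "w = x @ y"
    then show "(x, y) \<in> (\<lambda>i. (take i (x @ y), drop i (x @ y))) ` {..length (x @ y)}"
      by (intro image_eqI[of _ _ "length x"]) auto
  qed
qed simp

lemma free_algebra_mult_assoc:
  fixes f g h :: "'x list \<Rightarrow> int"
  shows "(\<Sum>(x, z) | x @ z = w. (\<Sum>(a, b) | a @ b = x. f a * g b) * h z) =
    (\<Sum>(a, y) | a @ y = w. f a * (\<Sum>(b, z) | b @ z = y. g b * h z))"
proof -
  have "(\<Sum>(x, z) | x @ z = w. (\<Sum>(a, b) | a @ b = x. f a * g b) * h z) =
      (\<Sum>p \<in> {(x, z). x @ z = w}. \<Sum>q \<in> {(a, b). a @ b = fst p}.
        f (fst q) * g (snd q) * h (snd p))"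
    by (simp add: sum_distrib_right split_beta)
  also have "\<dots> = (\<Sum>(p, q) \<in> (SIGMA p:{(x, z). x @ z = w}. {(a, b). a @ b = fst p}).
      f (fst q) * g (snd q) * h (snd p))"
    by (intro sum.Sigma finite_splits ballI)
  also have "\<dots> = (\<Sum>(p, q) \<in> (SIGMA p:{(a, y). a @ y = w}. {(b, z). b @ z = snd p}).
      f (fst p) * (g (fst q) * h (snd q)))"
    by (rule sum.reindex_bij_witness
        [where j = "\<lambda>((x, z), (a, b)). ((a, b @ z), (b, z))"
           and i = "\<lambda>((a, y), (b, z)). ((a @ b, z), (a, b))"]) (auto simp: mult.assoc)
  also have "\<dots> = (\<Sum>p \<in> {(a, y). a @ y = w}. \<Sum>q \<in> {(b, z). b @ z = snd p}.
      f (fst p) * (g (fst q) * h (snd q)))"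
    by (intro sum.Sigma[symmetric] finite_splits ballI)
  also have "\<dots> = (\<Sum>(a, y) | a @ y = w. f a * (\<Sum>(b, z) | b @ z = y. g b * h z))"
    by (simp add: sum_distrib_left split_beta)
  finally show ?thesis .
qed

lemma free_algebra_mult_closed:
  assumes "f \<in> carrier (free_algebra X)" "g \<in> carrier (free_algebra X)"
  shows "f \<otimes>\<^bsub>free_algebra X\<^esub> g \<in> carrier (free_algebra X)"
proof -
  let ?P = "{w. (f \<otimes>\<^bsub>free_algebra X\<^esub> g) w \<noteq> 0}"
  have sub: "?P \<subseteq> (\<lambda>(x, y). x @ y) ` ({w. f w \<noteq> 0} \<times> {w. g w \<noteq> 0})"
  proof
    fix w assume "w \<in> ?P"
    then have "(\<Sum>(x, y) | x @ y = w. f x * g y) \<noteq> 0"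
      by (simp add: free_algebra_def)
    then obtain p where "p \<in> {(x, y). x @ y = w}" "(case p of (x, y) \<Rightarrow> f x * g y) \<noteq> 0"
      by (rule sum.not_neutral_contains_not_neutral)
    then show "w \<in> (\<lambda>(x, y). x @ y) ` ({w. f w \<noteq> 0} \<times> {w. g w \<noteq> 0})"
      by (intro image_eqI[of _ _ p]) auto
  qed
  have "finite ?P"
    using assms by (intro finite_subset[OF sub]) (auto simp: free_algebra_def)
  moreover have "?P \<subseteq> lists X"
    using assms by (intro order_trans[OF sub]) (force simp: free_algebra_def)
  ultimately show ?thesis
    by (simp add: free_algebra_def)
qed

lemma ring_free_algebra:
  fixes X :: "'x set"
  shows "ring (free_algebra X)"
proof (rule ringI)
  show "abelian_group (free_algebra X)"
  proof (rule abelian_groupI)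
    fix f g assume fg: "f \<in> carrier (free_algebra X)" "g \<in> carrier (free_algebra X)"
    have "{w. f w + g w \<noteq> 0} \<subseteq> {w. f w \<noteq> 0} \<union> {w. g w \<noteq> 0}"
      by auto
    then show "f \<oplus>\<^bsub>free_algebra X\<^esub> g \<in> carrier (free_algebra X)"
      using fg by (auto simp: free_algebra_def intro: finite_subset)
  next
    fix f assume "f \<in> carrier (free_algebra X)"
    then show "\<exists>g \<in> carrier (free_algebra X). g \<oplus>\<^bsub>free_algebra X\<^esub> f = \<zero>\<^bsub>free_algebra X\<^esub>"
      by (intro bexI[of _ "\<lambda>w. - f w"]) (auto simp: free_algebra_def)
  qed (auto simp: free_algebra_def)
  show "Group.monoid (free_algebra X)"
  proof (rule Group.monoidI)
    fix f assume "f \<in> carrier (free_algebra X)"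
    have 1: "(\<Sum>(x, y) | x @ y = w. (if x = [] then 1 else 0) * f y) = f w" for w
    proof -
      have "(\<Sum>(x, y) | x @ y = w. (if x = [] then 1 else 0) * f y) =
          (\<Sum>(x, y) \<in> {([] :: 'x list, w)}. (if x = [] then 1 else 0) * f y)"
        by (rule sum.mono_neutral_right) (auto simp: finite_splits split: if_splits)
      then show ?thesis by simp
    qed
    have 2: "(\<Sum>(x, y) | x @ y = w. f x * (if y = [] then 1 else 0)) = f w" for w
    proof -
      have "(\<Sum>(x, y) | x @ y = w. f x * (if y = [] then 1 else 0)) =
          (\<Sum>(x, y) \<in> {(w, [] :: 'x list)}. f x * (if y = [] then 1 else 0))"
        by (rule sum.mono_neutral_right) (auto simp: finite_splits split: if_splits)
      then show ?thesis by simp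
    qed
    show "\<one>\<^bsub>free_algebra X\<^esub> \<otimes>\<^bsub>free_algebra X\<^esub> f = f"
      using 1 by (simp add: free_algebra_def)
    show "f \<otimes>\<^bsub>free_algebra X\<^esub> \<one>\<^bsub>free_algebra X\<^esub> = f"
      using 2 by (simp add: free_algebra_def)
  qed (auto simp: free_algebra_mult_closed, auto simp: free_algebra_def free_algebra_mult_assoc)
qed (auto simp: free_algebra_def fun_eq_iff split_beta algebra_simps sum.distrib)

lemma free_gen_closed: "a \<in> X \<Longrightarrow> free_gen a \<in> carrier (free_algebra X)"
  by (auto simp: free_gen_def free_algebra_def)


section \<open>The letterplace algebra\<close>

text \<open>The pair \<open>(x, i)\<close> stands for the symbol $(x|i)$.\<close>

definition lp_symbols :: "'a set \<Rightarrow> ('a \<times> nat) set" where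
  "lp_symbols S = S \<times> {1, 2}"

definition skew_ideal :: "'x set \<Rightarrow> ('x list \<Rightarrow> int) set" where
  "skew_ideal X = genideal (free_algebra X)
    ({free_gen a \<otimes>\<^bsub>free_algebra X\<^esub> free_gen a | a. a \<in> X} \<union>
     {free_gen a \<otimes>\<^bsub>free_algebra X\<^esub> free_gen b \<oplus>\<^bsub>free_algebra X\<^esub>
        free_gen b \<otimes>\<^bsub>free_algebra X\<^esub> free_gen a | a b. a \<in> X \<and> b \<in> X})"

definition Skew :: "'a set \<Rightarrow> (('a \<times> nat) list \<Rightarrow> int) set ring" where
  "Skew S = free_algebra (lp_symbols S) Quot skew_ideal (lp_symbols S)"

definition letter :: "'a set \<Rightarrow> 'a \<Rightarrow> nat \<Rightarrow> (('a \<times> nat) list \<Rightarrow> int) set" where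
  "letter S x i = skew_ideal (lp_symbols S) +>\<^bsub>free_algebra (lp_symbols S)\<^esub> free_gen (x, i)"

lemma ideal_skew_ideal: "ideal (skew_ideal X) (free_algebra X)"
proof -
  interpret ring "free_algebra X" by (rule ring_free_algebra)
  show ?thesis
    unfolding skew_ideal_def by (rule genideal_ideal) (auto simp: free_gen_closed)
qed

lemma ring_Skew: "ring (Skew S)"
  unfolding Skew_def by (rule ideal.quotient_is_ring[OF ideal_skew_ideal])

lemma letter_closed:
  assumes "x \<in> S" "i \<in> {1, 2}"
  shows "letter S x i \<in> carrier (Skew S)"
proof -
  have "free_gen (x, i) \<in> carrier (free_algebra (lp_symbols S))"
    using assms by (intro free_gen_closed) (auto simp: lp_symbols_def)
  then show ?thesis
    using ring_hom_closed[OF ideal.rcos_ring_hom[OF ideal_skew_ideal]]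
    unfolding letter_def Skew_def by blast
qed


section \<open>Slices and biproducts\<close>

text \<open>
  Positions in a word of length \<open>r\<close> are numbered \<open>0, \<dots>, r - 1\<close>. The permutation lists the
  elements of \<open>I\<close> increasingly, followed by those of its complement.
\<close>

definition slice_perm :: "nat \<Rightarrow> nat set \<Rightarrow> nat \<Rightarrow> nat" where
  "slice_perm r I i =
    (if i < r then (sorted_list_of_set I @ sorted_list_of_set ({..<r} - I)) ! i else i)"

definition slice_sum ::
  "('b, 'm) ring_scheme \<Rightarrow> 'a list \<Rightarrow> nat \<Rightarrow> nat \<Rightarrow> ('a list \<Rightarrow> 'a list \<Rightarrow> 'b) \<Rightarrow> 'b" where
  "slice_sum R w r1 r2 f =
    (\<Oplus>\<^bsub>R\<^esub> I \<in> {I. I \<subseteq> {..<length w} \<and> card I = r1 \<and> card ({..<length w} - I) = r2}.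
      [sign (slice_perm (length w) I)] \<cdot>\<^bsub>R\<^esub> f (nths w I) (nths w ({..<length w} - I)))"

definition place_word :: "'a set \<Rightarrow> nat \<Rightarrow> 'a list \<Rightarrow> (('a \<times> nat) list \<Rightarrow> int) set" where
  "place_word S i w = foldr (\<lambda>x a. letter S x i \<otimes>\<^bsub>Skew S\<^esub> a) w \<one>\<^bsub>Skew S\<^esub>"

definition biproduct ::
  "'a set \<Rightarrow> 'a list \<Rightarrow> nat \<Rightarrow> nat \<Rightarrow> (('a \<times> nat) list \<Rightarrow> int) set" where
  "biproduct S w r1 r2 =
    slice_sum (Skew S) w r1 r2 (\<lambda>w1 w2. place_word S 1 w1 \<otimes>\<^bsub>Skew S\<^esub> place_word S 2 w2)"

lemma slice_perm_permutes:
  assumes "I \<subseteq> {..<r}"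
  shows "slice_perm r I permutes {..<r}"
proof -
  let ?xs = "sorted_list_of_set I @ sorted_list_of_set ({..<r} - I)"
  have fin: "finite I"
    using assms finite_subset by blast
  have len: "length ?xs = r"
    using assms fin card_mono[OF _ assms] by (simp add: card_Diff_subset)
  have "bij_betw ((!) ?xs) {..<length ?xs} (set ?xs)"
    using fin by (intro bij_betw_nth) auto
  moreover have "set ?xs = {..<r}"
    using assms fin by auto
  ultimately have "bij_betw ((!) ?xs) {..<r} {..<r}"
    by (simp only: len)
  then have "bij_betw (slice_perm r I) {..<r} {..<r}"
    by (rule bij_betw_cong[THEN iffD1, rotated]) (simp add: slice_perm_def)
  then show ?thesis
    by (rule bij_imp_permutes) (simp add: slice_perm_def)
qed

lemma place_word_closed:
  assumes "set w \<subseteq> S" "i \<in> {1, 2}"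
  shows "place_word S i w \<in> carrier (Skew S)"
proof -
  interpret ring "Skew S" by (rule ring_Skew)
  show ?thesis
    using assms(1) by (induction w) (auto simp: place_word_def letter_closed[OF _ assms(2)])
qed

lemma slice_sum_closed:
  assumes "ring R" "\<And>w1 w2. set w1 \<subseteq> set w \<Longrightarrow> set w2 \<subseteq> set w \<Longrightarrow> f w1 w2 \<in> carrier R"
  shows "slice_sum R w r1 r2 f \<in> carrier R"
proof -
  interpret ring R by fact
  show ?thesis
    unfolding slice_sum_def
    by (intro finsum_closed Pi_I add.int_pow_closed assms(2) set_nths_subset)
qed

lemma biproduct_closed:
  assumes "set w \<subseteq> S"
  shows "biproduct S w r1 r2 \<in> carrier (Skew S)"
proof -
  interpret ring "Skew S" by (rule ring_Skew)
  show ?thesis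
    unfolding biproduct_def using assms
    by (intro slice_sum_closed ring_axioms m_closed place_word_closed) auto
qed


section \<open>The second Whitney algebra\<close>

definition whitney_ideal :: "'a set \<Rightarrow> ('a set \<Rightarrow> bool) \<Rightarrow> (('a \<times> nat) list \<Rightarrow> int) set set" where
  "whitney_ideal S indep = genideal (Skew S)
    {biproduct S w r1 r2 | w r1 r2. set w \<subseteq> S \<and> \<not> indep (set w) \<and> r1 + r2 = length w}"

definition Whitney2 ::
  "'a set \<Rightarrow> ('a set \<Rightarrow> bool) \<Rightarrow> (('a \<times> nat) list \<Rightarrow> int) set set ring" where
  "Whitney2 S indep = Skew S Quot whitney_ideal S indep"

definition whitney_class :: "'a set \<Rightarrow> ('a set \<Rightarrow> bool) \<Rightarrow>
    (('a \<times> nat) list \<Rightarrow> int) set \<Rightarrow> (('a \<times> nat) list \<Rightarrow> int) set set" where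
  "whitney_class S indep a = whitney_ideal S indep +>\<^bsub>Skew S\<^esub> a"

lemma ideal_whitney_ideal: "ideal (whitney_ideal S indep) (Skew S)"
proof -
  interpret ring "Skew S" by (rule ring_Skew)
  show ?thesis
    unfolding whitney_ideal_def by (rule genideal_ideal) (auto simp: biproduct_closed)
qed

lemma ring_Whitney2: "ring (Whitney2 S indep)"
  unfolding Whitney2_def by (rule ideal.quotient_is_ring[OF ideal_whitney_ideal])

lemma whitney_class_ring_hom: "whitney_class S indep \<in> ring_hom (Skew S) (Whitney2 S indep)"
  using ideal.rcos_ring_hom[OF ideal_whitney_ideal]
  unfolding whitney_class_def[abs_def] Whitney2_def .

end

theory Submission
  imports Defs "Jordan_Normal_Form.Determinant"
begin

text \<open>
  Write $a_x = (x|1)$ and $b_x = (x|2)$, and let $t$ be a central indeterminate. Expanding the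
  product of the $a_x + t b_x$ over the letters of a word $w$ and sorting the factors $b_x$ to the
  right produces the signs of the slices, so the coefficient of $t^j$ is the biproduct
  $(w|1^{(|w|-j)}2^{(j)})$. Denote the product by $P_w(t)$.

  Introduce a second indeterminate $s$ and let $X_{i,j}$ be the coefficient of $t^i s^j$ in
  $P_u(t) P_v(t+s)$. Choosing first the letters of $v$ that contribute the $s$, one finds
  \[ X_{i,j} = \sum_{(v)_{(q-j,j)}} (u v_{(1)}|1^{(p+q-i-j)}2^{(i)})\,(v_{(2)}|2^{(j)}). \]
  In particular, $X_{0,k}$ is the left-hand side of the identity. If $i + j = k$ and $i > 0$, then
  $u v_{(1)}$ has length $p+q-j$, which exceeds the rank $p+q-k$ of $A \cup B$; thus the word is
  dependent, or it has a repeated letter and its biproducts are zero by skew-symmetry. Hence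
  $X_{i,j}$ is zero in the Whitney algebra.

  Now put $s = -t$. This turns $P_v(t+s)$ into $P_v(0) = (v|1^{(q)})$, and comparing coefficients
  of $t^k$ gives
  \[ \sum_{j \le k} (-1)^j X_{k-j,j} = (u|1^{(p-k)}2^{(k)})\,(v|1^{(q)}). \]
  In the Whitney algebra the left-hand side reduces to $(-1)^k X_{0,k}$. Moving the $q$ letters of
  $v$ to the front of the right-hand side yields the sign $(-1)^{pq}$ and the sum over the slices
  of $u$ in the statement.

  The polynomials are represented by their coefficients: \<open>polar w j\<close> for $P_w(t)$, \<open>polar2 u v i j\<close>
  for $X_{i,j}$. The link with slices is \<open>graded_coslice_sum_Cons\<close>; the substitution is
  \<open>alternating_sum_polar2\<close>; the treatment of repeated letters is \<open>polar_not_distinct\<close>.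
\<close>

section \<open>Slices of a nonempty word\<close>

lemma sorted_list_of_set_image_Suc:
  assumes "finite A"
  shows "sorted_list_of_set (Suc ` A) = map Suc (sorted_list_of_set A)"
proof -
  have "sorted_list_of_set (set (map Suc (sorted_list_of_set A))) = map Suc (sorted_list_of_set A)"
    by (rule sorted_list_of_set.idem_if_sorted_distinct) (auto simp: distinct_map sorted_map)
  then show ?thesis using assms by simp
qed

lemma sorted_list_of_set_insert_0_image_Suc:
  assumes "finite A"
  shows "sorted_list_of_set (insert 0 (Suc ` A)) = 0 # map Suc (sorted_list_of_set A)"
proof -
  have "sorted_list_of_set (set (0 # map Suc (sorted_list_of_set A))) = 0 # map Suc (sorted_list_of_set A)"
    by (rule sorted_list_of_set.idem_if_sorted_distinct) (auto simp: distinct_map sorted_map)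
  then show ?thesis using assms by simp
qed

text \<open>
  Prefixing a letter to a word shifts all positions by one and adds position \<open>0\<close>. In the list
  that defines the slice permutation, the new entry \<open>0\<close> stands first if it belongs to the first
  part of the slice, and directly behind the first part otherwise. Both are insertions of the
  value \<open>0\<close> into a permutation, whose effect on the sign is known.
\<close>

lemma slice_perm_insert_0:
  assumes "I \<subseteq> {..<n}"
  shows "slice_perm (Suc n) (insert 0 (Suc ` I)) = permutation_insert 0 0 (slice_perm n I)"
proof
  fix i
  have fin: "finite I" using assms finite_subset by blast
  have compl: "{..<Suc n} - insert 0 (Suc ` I) = Suc ` ({..<n} - I)"
    using lessThan_Suc_eq_insert_0 by auto
  have len: "length (sorted_list_of_set I @ sorted_list_of_set ({..<n} - I)) = n"
    using assms fin card_mono[OF _ assms] by (simp add: card_Diff_subset)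
  show "slice_perm (Suc n) (insert 0 (Suc ` I)) i = permutation_insert 0 0 (slice_perm n I) i"
  proof (cases i)
    case 0
    then show ?thesis
      unfolding slice_perm_def sorted_list_of_set_insert_0_image_Suc[OF fin] by simp
  next
    case (Suc i')
    then show ?thesis
      using len unfolding slice_perm_def compl sorted_list_of_set_insert_0_image_Suc[OF fin]
      by (simp add: sorted_list_of_set_image_Suc permutation_insert_expand flip: map_append)
  qed
qed

lemma slice_perm_image_Suc:
  assumes "I \<subseteq> {..<n}"
  shows "slice_perm (Suc n) (Suc ` I) = permutation_insert (card I) 0 (slice_perm n I)"
proof
  fix i
  have fin: "finite I" using assms finite_subset by blast
  have compl: "{..<Suc n} - Suc ` I = insert 0 (Suc ` ({..<n} - I))"
    using lessThan_Suc_eq_insert_0 by auto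
  have card: "card I \<le> n" "card ({..<n} - I) = n - card I"
    using assms fin card_mono[OF _ assms] by (simp_all add: card_Diff_subset)
  consider "i < card I" | "i = card I" | i' where "i = Suc i'" "card I \<le> i'"
    by (metis linorder_less_linear less_Suc_eq_le Suc_pred not_less_zero bot_nat_0.not_eq_extremum)
  then show "slice_perm (Suc n) (Suc ` I) i = permutation_insert (card I) 0 (slice_perm n I) i"
    using card unfolding slice_perm_def compl
      sorted_list_of_set_insert_0_image_Suc[OF finite_Diff[OF finite_lessThan]]
    by cases (simp_all add: fin sorted_list_of_set_image_Suc permutation_insert_expand nth_append
        nth_Cons' Suc_diff_le less_diff_conv2)
qed

lemma sign_slice_perm_insert_0:
  assumes "I \<subseteq> {..<n}"
  shows "sign (slice_perm (Suc n) (insert 0 (Suc ` I))) = sign (slice_perm n I)"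
  using signof_permutation_insert[of "slice_perm n I" n 0 0, where ?'a = int] slice_perm_permutes[OF assms]
  by (simp add: slice_perm_insert_0[OF assms] lessThan_atLeast0)

lemma sign_slice_perm_image_Suc:
  assumes "I \<subseteq> {..<n}"
  shows "sign (slice_perm (Suc n) (Suc ` I)) = (- 1) ^ card I * sign (slice_perm n I)"
proof -
  have "card I \<le> n" using card_mono[OF _ assms] by simp
  then show ?thesis
    using signof_permutation_insert[of "slice_perm n I" n "card I" 0, where ?'a = int] slice_perm_permutes[OF assms]
    by (simp add: slice_perm_image_Suc[OF assms] lessThan_atLeast0 less_Suc_eq_le)
qed

text \<open>
  The first letter goes either to the first or to the second part of a slice; this is what
  makes induction on words possible for slice sums.
\<close>

lemma slices_Cons:
  fixes n r1 r2 :: nat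
  defines "P \<equiv> \<lambda>n r1 r2. {I. I \<subseteq> {..<n} \<and> card I = r1 \<and> card ({..<n} - I) = r2}"
  shows "P (Suc n) r1 r2 =
    (if r1 = 0 then {} else (\<lambda>I. insert 0 (Suc ` I)) ` P n (r1 - 1) r2) \<union>
    (if r2 = 0 then {} else (\<lambda>I. Suc ` I) ` P n r1 (r2 - 1))"
    (is "_ = ?A \<union> ?B")
proof
  have c1: "{..<Suc n} - insert 0 (Suc ` I) = Suc ` ({..<n} - I)" for I
    using lessThan_Suc_eq_insert_0 by auto
  have c2: "{..<Suc n} - Suc ` I = insert 0 (Suc ` ({..<n} - I))" for I
    using lessThan_Suc_eq_insert_0 by auto
  have card1: "card (insert 0 (Suc ` I)) = Suc (card I)" if "finite I" for I
    using that by (simp add: card_image)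
  have fin: "finite I" if "I \<subseteq> {..<n}" for I
    using that finite_subset by blast
  show "P (Suc n) r1 r2 \<subseteq> ?A \<union> ?B"
  proof
    fix I assume I: "I \<in> P (Suc n) r1 r2"
    define I' where "I' = {j. Suc j \<in> I}"
    have sub: "I' \<subseteq> {..<n}" using I by (auto simp: P_def I'_def)
    show "I \<in> ?A \<union> ?B"
    proof (cases "0 \<in> I")
      case True
      have "x \<in> I \<longleftrightarrow> x \<in> insert 0 (Suc ` I')" for x
        using True by (cases x) (auto simp: I'_def)
      then have eq: "I = insert 0 (Suc ` I')" by blast
      with I fin[OF sub] sub have "I' \<in> P n (r1 - 1) r2" "r1 \<noteq> 0"
        by (auto simp: P_def c1 card1 card_image simp del: card_insert_disjoint)
      then show ?thesis by (simp add: eq)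
    next
      case False
      have "x \<in> I \<longleftrightarrow> x \<in> Suc ` I'" for x
        using False by (cases x) (auto simp: I'_def)
      then have eq: "I = Suc ` I'" by blast
      with I sub have "I' \<in> P n r1 (r2 - 1)" "r2 \<noteq> 0"
        by (auto simp: P_def c2 card1 card_image simp del: card_insert_disjoint)
      then show ?thesis by (simp add: eq)
    qed
  qed
  show "?A \<union> ?B \<subseteq> P (Suc n) r1 r2"
  proof (intro Un_least subsetI)
    fix I assume "I \<in> ?A"
    then obtain I' where I': "r1 \<noteq> 0" "I' \<in> P n (r1 - 1) r2" and eq: "I = insert 0 (Suc ` I')"
      by (auto split: if_splits)
    then show "I \<in> P (Suc n) r1 r2"
      using fin[of I'] unfolding P_def eq mem_Collect_eq c1 by (auto simp: card1 card_image)
  next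
    fix I assume "I \<in> ?B"
    then obtain I' where I': "r2 \<noteq> 0" "I' \<in> P n r1 (r2 - 1)" and eq: "I = Suc ` I'"
      by (auto split: if_splits)
    then show "I \<in> P (Suc n) r1 r2"
      unfolding P_def eq mem_Collect_eq c2 by (auto simp: card1 card_image)
  qed
qed

section \<open>Slice sums in a ring\<close>

lemma (in ring) finsum_int_pow:
  fixes c :: int
  assumes "finite A" "\<And>i. i \<in> A \<Longrightarrow> g i \<in> carrier R"
  shows "(\<Oplus>i \<in> A. [c] \<cdot> g i) = [c] \<cdot> (\<Oplus>i \<in> A. g i)"
proof -
  have scalar: "[c] \<cdot> x = ([c] \<cdot> \<one>) \<otimes> x" if "x \<in> carrier R" for x
    using add_pow_ldistr_int[of \<one> x c] that by simp
  have "(\<Oplus>i \<in> A. [c] \<cdot> g i) = (\<Oplus>i \<in> A. ([c] \<cdot> \<one>) \<otimes> g i)"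
    using assms(2) by (intro finsum_cong') (auto intro: scalar)
  also have "\<dots> = [c] \<cdot> (\<Oplus>i \<in> A. g i)"
    using assms by (subst scalar) (auto simp: finsum_rdistr)
  finally show ?thesis .
qed

lemma (in ring) slice_sum_Nil:
  "f [] [] \<in> carrier R \<Longrightarrow>
    slice_sum R [] r1 r2 f = (if r1 = 0 \<and> r2 = 0 then f [] [] else \<zero>)"
proof -
  assume f: "f [] [] \<in> carrier R"
  have 1: "slice_perm 0 {} = id" by (auto simp: slice_perm_def)
  have 2: "{I. I = {} \<and> card I = r1 \<and> r2 = 0} = (if r1 = 0 \<and> r2 = 0 then {{}} else {})"
    by auto
  show ?thesis using f by (simp add: slice_sum_def 1 2)
qed

text \<open>
  If the first letter goes to the second part, it has to jump over the \<open>r1\<close> letters of the first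
  part; this is the sign in the second summand.
\<close>

lemma (in ring) slice_sum_Cons:
  assumes f: "\<And>w1 w2. set w1 \<subseteq> set (x # w) \<Longrightarrow> set w2 \<subseteq> set (x # w) \<Longrightarrow> f w1 w2 \<in> carrier R"
  shows "slice_sum R (x # w) r1 r2 f =
    (if r1 = 0 then \<zero> else slice_sum R w (r1 - 1) r2 (\<lambda>w1 w2. f (x # w1) w2)) \<oplus>
    (if r2 = 0 then \<zero> else [((- 1 :: int) ^ r1)] \<cdot> slice_sum R w r1 (r2 - 1) (\<lambda>w1 w2. f w1 (x # w2)))"
proof -
  let ?n = "length w"
  define P where "P r1 r2 = {I. I \<subseteq> {..<?n} \<and> card I = r1 \<and> card ({..<?n} - I) = r2}" for r1 r2
  define F where "F I = [(sign (slice_perm (Suc ?n) I))] \<cdot> f (nths (x # w) I) (nths (x # w) ({..<Suc ?n} - I))" for I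
  let ?A = "if r1 = 0 then {} else (\<lambda>I. insert 0 (Suc ` I)) ` P (r1 - 1) r2"
  let ?B = "if r2 = 0 then {} else (\<lambda>I. Suc ` I) ` P r1 (r2 - 1)"
  have finP: "finite (P r1 r2)" for r1 r2
    unfolding P_def by simp
  have Fc: "F I \<in> carrier R" for I
    unfolding F_def by (intro add.int_pow_closed f set_nths_subset)
  have "slice_sum R (x # w) r1 r2 f = (\<Oplus>I \<in> ?A \<union> ?B. F I)"
    unfolding slice_sum_def F_def P_def using slices_Cons[of "?n" r1 r2] by simp
  also have "\<dots> = (\<Oplus>I \<in> ?A. F I) \<oplus> (\<Oplus>I \<in> ?B. F I)"
    using Fc finP by (intro finsum_Un_disjoint) auto
  also have "(\<Oplus>I \<in> ?A. F I) =
      (if r1 = 0 then \<zero> else slice_sum R w (r1 - 1) r2 (\<lambda>w1 w2. f (x # w1) w2))"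
  proof (cases "r1 = 0")
    case False
    have inj: "inj_on (\<lambda>I. insert 0 (Suc ` I)) (P (r1 - 1) r2)"
      by (rule inj_onI) (metis Diff_insert_absorb nat.distinct(1) image_iff inj_Suc inj_image_eq_iff)
    have "(\<Oplus>I \<in> ?A. F I) = (\<Oplus>I \<in> P (r1 - 1) r2. F (insert 0 (Suc ` I)))"
      using False Fc finsum_reindex[OF _ inj, of F] by simp
    also have "\<dots> = slice_sum R w (r1 - 1) r2 (\<lambda>w1 w2. f (x # w1) w2)"
      unfolding slice_sum_def P_def[symmetric]
    proof (rule finsum_cong', simp)
      fix I assume "I \<in> P (r1 - 1) r2"
      then have I: "I \<subseteq> {..<?n}" by (simp add: P_def)
      have "{j. Suc j \<in> insert 0 (Suc ` I)} = I" by auto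
      moreover have "{j. Suc j \<in> {..<Suc ?n} - insert 0 (Suc ` I)} = {..<?n} - I" by auto
      ultimately show "F (insert 0 (Suc ` I)) = [(sign (slice_perm ?n I))] \<cdot> f (x # nths w I) (nths w ({..<?n} - I))"
        unfolding F_def sign_slice_perm_insert_0[OF I] nths_Cons by simp
    next
      have "set (x # nths w I) \<subseteq> set (x # w)" "set (nths w J) \<subseteq> set (x # w)" for I J
        using set_nths_subset[of w I] set_nths_subset[of w J] by auto
      then show "(\<lambda>I. [(sign (slice_perm ?n I))] \<cdot> f (x # nths w I) (nths w ({..<?n} - I)))
          \<in> P (r1 - 1) r2 \<rightarrow> carrier R"
        by (intro Pi_I add.int_pow_closed f)
    qed
    finally show ?thesis using False by simp
  qed simp
  also have "(\<Oplus>I \<in> ?B. F I) =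
      (if r2 = 0 then \<zero> else [((- 1 :: int) ^ r1)] \<cdot> slice_sum R w r1 (r2 - 1) (\<lambda>w1 w2. f w1 (x # w2)))"
  proof (cases "r2 = 0")
    case False
    have inj: "inj_on (\<lambda>I. Suc ` I) (P r1 (r2 - 1))"
      by (rule inj_onI) (metis inj_Suc inj_image_eq_iff)
    define G where "G I = [(sign (slice_perm ?n I))] \<cdot> f (nths w I) (x # nths w ({..<?n} - I))" for I
    have "set (nths w I) \<subseteq> set (x # w)" "set (x # nths w J) \<subseteq> set (x # w)" for I J
      using set_nths_subset[of w I] set_nths_subset[of w J] by auto
    then have fc: "f (nths w I) (x # nths w J) \<in> carrier R" for I J
      by (intro f)
    then have Gc: "G I \<in> carrier R" for I
      unfolding G_def by (intro add.int_pow_closed)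
    have "(\<Oplus>I \<in> ?B. F I) = (\<Oplus>I \<in> P r1 (r2 - 1). F (Suc ` I))"
      using False Fc finsum_reindex[OF _ inj, of F] by simp
    also have "\<dots> = (\<Oplus>I \<in> P r1 (r2 - 1). [((- 1 :: int) ^ r1)] \<cdot> G I)"
    proof (rule finsum_cong', simp)
      fix I assume "I \<in> P r1 (r2 - 1)"
      then have I: "I \<subseteq> {..<?n}" and card: "card I = r1" by (auto simp: P_def)
      have "{j. Suc j \<in> Suc ` I} = I" by auto
      moreover have "{j. Suc j \<in> {..<Suc ?n} - Suc ` I} = {..<?n} - I" by auto
      moreover have "0 \<in> {..<Suc ?n} - Suc ` I" "0 \<notin> Suc ` I" by auto
      ultimately show "F (Suc ` I) = [((- 1 :: int) ^ r1)] \<cdot> G I"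
        unfolding F_def G_def sign_slice_perm_image_Suc[OF I] nths_Cons card
        by (simp add: add.int_pow_pow[OF fc] mult.commute)
    qed (use Gc in auto)
    also have "\<dots> = [((- 1 :: int) ^ r1)] \<cdot> (\<Oplus>I \<in> P r1 (r2 - 1). G I)"
      by (rule finsum_int_pow) (use Gc finP in auto)
    finally show ?thesis using False by (simp add: slice_sum_def G_def P_def)
  qed simp
  finally show ?thesis .
qed

context ring
begin

lemma sign_scale:
  "x \<in> carrier R \<Longrightarrow> [((- 1 :: int) ^ n)] \<cdot> x = (if even n then x else \<ominus> x)"
  by (simp add: minus_one_power_iff add.int_pow_neg)

lemma slice_sum_eq_zero:
  assumes "r1 + r2 \<noteq> length w"
  shows "slice_sum R w r1 r2 f = \<zero>"
proof -
  have "card I + card ({..<length w} - I) = length w" if "I \<subseteq> {..<length w}" for I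
    using that card_mono[OF _ that] finite_subset[OF that] by (simp add: card_Diff_subset)
  then have "{I. I \<subseteq> {..<length w} \<and> card I = r1 \<and> card ({..<length w} - I) = r2} = {}"
    using assms by blast
  then show ?thesis by (simp only: slice_sum_def finsum_empty)
qed

lemma slice_sum_cong:
  assumes eq: "\<And>w1 w2. set w1 \<subseteq> set w \<Longrightarrow> set w2 \<subseteq> set w \<Longrightarrow> length w1 = r1 \<Longrightarrow>
      length w2 = r2 \<Longrightarrow> f w1 w2 = g w1 w2"
    and g: "\<And>w1 w2. set w1 \<subseteq> set w \<Longrightarrow> set w2 \<subseteq> set w \<Longrightarrow> g w1 w2 \<in> carrier R"
  shows "slice_sum R w r1 r2 f = slice_sum R w r1 r2 g"
proof -
  have len: "length (nths w I) = card I" if "I \<subseteq> {..<length w}" for I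
    using that by (auto simp: length_nths intro!: arg_cong[where f = card])
  show ?thesis
    unfolding slice_sum_def
  proof (rule finsum_cong')
    fix I assume "I \<in> {I. I \<subseteq> {..<length w} \<and> card I = r1 \<and> card ({..<length w} - I) = r2}"
    then have "f (nths w I) (nths w ({..<length w} - I)) = g (nths w I) (nths w ({..<length w} - I))"
      by (intro eq set_nths_subset) (auto simp: len)
    then show "[(sign (slice_perm (length w) I))] \<cdot> f (nths w I) (nths w ({..<length w} - I)) =
        [(sign (slice_perm (length w) I))] \<cdot> g (nths w I) (nths w ({..<length w} - I))"
      by simp
  qed (auto intro!: add.int_pow_closed g set_nths_subset)
qed

lemma slice_sum_add:
  assumes f: "\<And>w1 w2. set w1 \<subseteq> set w \<Longrightarrow> set w2 \<subseteq> set w \<Longrightarrow> f w1 w2 \<in> carrier R"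
    and g: "\<And>w1 w2. set w1 \<subseteq> set w \<Longrightarrow> set w2 \<subseteq> set w \<Longrightarrow> g w1 w2 \<in> carrier R"
  shows "slice_sum R w r1 r2 (\<lambda>w1 w2. f w1 w2 \<oplus> g w1 w2) =
    slice_sum R w r1 r2 f \<oplus> slice_sum R w r1 r2 g"
  unfolding slice_sum_def
  by (subst finsum_addf[symmetric])
    (auto intro!: finsum_cong' f g set_nths_subset add.int_pow_closed add.int_pow_distrib)

lemma slice_sum_mult_left:
  assumes f: "\<And>w1 w2. set w1 \<subseteq> set w \<Longrightarrow> set w2 \<subseteq> set w \<Longrightarrow> f w1 w2 \<in> carrier R"
    and c: "c \<in> carrier R"
  shows "slice_sum R w r1 r2 (\<lambda>w1 w2. c \<otimes> f w1 w2) = c \<otimes> slice_sum R w r1 r2 f"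
  unfolding slice_sum_def
  by (subst finsum_rdistr)
    (auto intro!: finsum_cong' c f set_nths_subset add.int_pow_closed m_closed add_pow_rdistr_int[symmetric])

end

text \<open>
  Only the length of the second part is recorded. For \<open>j > length w\<close> the truncated
  difference is \<open>0\<close> and there are no slices at all, so that the sum vanishes. This makes the
  recursion over words uniform in \<open>j\<close>.
\<close>

definition coslice_sum where
  "coslice_sum R w j f = slice_sum R w (length w - j) j f"

context ring
begin

lemma coslice_sum_closed:
  assumes "\<And>w1 w2. set w1 \<subseteq> set w \<Longrightarrow> set w2 \<subseteq> set w \<Longrightarrow> f w1 w2 \<in> carrier R"
  shows "coslice_sum R w j f \<in> carrier R"
  unfolding coslice_sum_def using ring_axioms assms by (rule slice_sum_closed)

lemma coslice_sum_Nil: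
  "f [] [] \<in> carrier R \<Longrightarrow> coslice_sum R [] j f = (if j = 0 then f [] [] else \<zero>)"
  by (simp add: coslice_sum_def slice_sum_Nil)

lemma coslice_sum_Cons:
  assumes f: "\<And>w1 w2. set w1 \<subseteq> set (x # w) \<Longrightarrow> set w2 \<subseteq> set (x # w) \<Longrightarrow> f w1 w2 \<in> carrier R"
  shows "coslice_sum R (x # w) j f =
    coslice_sum R w j (\<lambda>w1 w2. f (x # w1) w2) \<oplus>
    (case j of 0 \<Rightarrow> \<zero>
     | Suc j' \<Rightarrow> [((- 1 :: int) ^ (length w - j'))] \<cdot> coslice_sum R w j' (\<lambda>w1 w2. f w1 (x # w2)))"
proof -
  have Cons: "slice_sum R (x # w) r1 r2 f =
      (if r1 = 0 then \<zero> else slice_sum R w (r1 - 1) r2 (\<lambda>w1 w2. f (x # w1) w2)) \<oplus>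
      (if r2 = 0 then \<zero> else [((- 1 :: int) ^ r1)] \<cdot> slice_sum R w r1 (r2 - 1) (\<lambda>w1 w2. f w1 (x # w2)))"
    for r1 r2
    by (rule slice_sum_Cons) (rule f)
  show ?thesis
proof (cases j)
  case 0
  have "slice_sum R w (length w) 0 (\<lambda>w1 w2. f (x # w1) w2) \<in> carrier R"
    by (rule slice_sum_closed[OF ring_axioms f]) auto
  with 0 show ?thesis
    by (simp add: coslice_sum_def Cons)
next
  case (Suc j')
  show ?thesis
  proof (cases "length w - j' = 0")
    case True
    then show ?thesis
      using Suc slice_sum_eq_zero[of "length w - j" j w]
      by (simp add: coslice_sum_def Cons)
  next
    case False
    then show ?thesis
      using Suc by (simp add: coslice_sum_def Cons)
  qed
qed
qed

lemmas coslice_sum_add = slice_sum_add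
  [where ?r1.0 = "length w - j" and ?r2.0 = j and w = w for w j, folded coslice_sum_def]
lemmas coslice_sum_mult_left = slice_sum_mult_left
  [where ?r1.0 = "length w - j" and ?r2.0 = j and w = w for w j, folded coslice_sum_def]
lemmas coslice_sum_cong = slice_sum_cong
  [where ?r1.0 = "length w - j" and ?r2.0 = j and w = w for w j, folded coslice_sum_def]

end

section \<open>Polarization in a skew-symmetric ring\<close>

text \<open>
  The elements \<open>a x\<close> and \<open>b x\<close> play the roles of the letters $(x|1)$ and $(x|2)$.
\<close>

locale skew_letters = ring R for R (structure) +
  fixes S :: "'x set" and a b :: "'x \<Rightarrow> 'a"
  assumes a_closed [simp]: "x \<in> S \<Longrightarrow> a x \<in> carrier R"
    and b_closed [simp]: "x \<in> S \<Longrightarrow> b x \<in> carrier R"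
    and anticommute: "c \<in> a ` S \<union> b ` S \<Longrightarrow> d \<in> a ` S \<union> b ` S \<Longrightarrow> c \<otimes> d = \<ominus> (d \<otimes> c)"
    and square_zero: "c \<in> a ` S \<union> b ` S \<Longrightarrow> c \<otimes> c = \<zero>"
begin

definition monomial :: "('x \<Rightarrow> 'a) \<Rightarrow> 'x list \<Rightarrow> 'a" where
  "monomial l w = foldr (\<lambda>x m. l x \<otimes> m) w \<one>"

text \<open>
  The biproduct, as the coefficient of \<open>t\<^sup>j\<close> in the product of the \<open>a x + t b x\<close> over the
  letters \<open>x\<close> of \<open>w\<close>, where \<open>t\<close> is a central indeterminate: sorting the factors \<open>b x\<close> to the
  right produces exactly the sign of the slice.
\<close>

definition polar :: "'x list \<Rightarrow> nat \<Rightarrow> 'a" where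
  "polar w j = coslice_sum R w j (\<lambda>w1 w2. monomial a w1 \<otimes> monomial b w2)"

text \<open>
  By the same principle, this is the coefficient of \<open>t\<^sup>i s\<^sup>j\<close> in the product of the
  \<open>a x + t b x\<close> over the letters of \<open>u\<close>, times the product of the \<open>a x + (t + s) b x\<close> over
  the letters of \<open>v\<close>. The slice singles out the letters of \<open>v\<close> for which \<open>s\<close> is chosen.
\<close>

definition polar2 :: "'x list \<Rightarrow> 'x list \<Rightarrow> nat \<Rightarrow> nat \<Rightarrow> 'a" where
  "polar2 u v i j = coslice_sum R v j (\<lambda>v1 v2. polar (u @ v1) i \<otimes> monomial b v2)"

lemma letter_carrier: "c \<in> a ` S \<union> b ` S \<Longrightarrow> c \<in> carrier R"
  by auto

lemma monomial_simps [simp]: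
  "monomial l [] = \<one>" "monomial l (x # w) = l x \<otimes> monomial l w"
  by (simp_all add: monomial_def)

lemma monomial_closed [simp]:
  "set w \<subseteq> S \<Longrightarrow> monomial a w \<in> carrier R" "set w \<subseteq> S \<Longrightarrow> monomial b w \<in> carrier R"
  by (induction w) auto

lemma monomial_append:
  "set w \<subseteq> S \<Longrightarrow> set w' \<subseteq> S \<Longrightarrow> monomial a (w @ w') = monomial a w \<otimes> monomial a w'"
  by (induction w) (auto simp: m_assoc)

lemma polar_closed [simp]: "set w \<subseteq> S \<Longrightarrow> polar w j \<in> carrier R"
  unfolding polar_def by (intro coslice_sum_closed m_closed monomial_closed) auto

lemma polar2_closed [simp]: "set u \<subseteq> S \<Longrightarrow> set v \<subseteq> S \<Longrightarrow> polar2 u v i j \<in> carrier R"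
  unfolding polar2_def by (intro coslice_sum_closed m_closed monomial_closed polar_closed) auto

text \<open>
  The induction step for all sign rules that follow: moving a letter past one more letter costs
  one more sign.
\<close>

lemma supercommute_mult:
  assumes c: "c \<in> a ` S \<union> b ` S" and d: "d \<in> a ` S \<union> b ` S" and m: "m \<in> carrier R"
    and comm: "c \<otimes> m = [((- 1 :: int) ^ n)] \<cdot> (m \<otimes> c)"
  shows "c \<otimes> (d \<otimes> m) = [((- 1 :: int) ^ Suc n)] \<cdot> ((d \<otimes> m) \<otimes> c)"
proof -
  note carr = letter_carrier[OF c] letter_carrier[OF d] m
  have "c \<otimes> (d \<otimes> m) = \<ominus> (d \<otimes> (c \<otimes> m))"
    using carr anticommute[OF c d] by (simp add: l_minus flip: m_assoc)
  then show ?thesis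
    unfolding comm using carr by (auto simp: sign_scale r_minus m_assoc add.int_pow_neg)
qed

lemma monomial_supercommute:
  assumes "c \<in> a ` S \<union> b ` S" "set w \<subseteq> S"
  shows "c \<otimes> monomial a w = [((- 1 :: int) ^ length w)] \<cdot> (monomial a w \<otimes> c)"
  using assms(2)
proof (induction w)
  case Nil
  then show ?case using letter_carrier[OF assms(1)] by simp
next
  case (Cons x w)
  then show ?case using supercommute_mult[OF assms(1), of "a x" "monomial a w" "length w"] by auto
qed

text \<open>
  If the letter \<open>b x\<close> is pulled to the front of the whole product instead of the front of the
  second factor, it passes the first factor, and the sign of this move cancels the sign of the
  slice. The recursions below are therefore free of signs.
\<close>

lemma graded_coslice_sum_Cons:
  assumes x: "x \<in> S" and w: "set w \<subseteq> S"
    and M: "\<And>w1. set w1 \<subseteq> S \<Longrightarrow> M w1 \<in> carrier R"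
    and comm: "\<And>w1. set w1 \<subseteq> S \<Longrightarrow> b x \<otimes> M w1 = [((- 1 :: int) ^ length w1)] \<cdot> (M w1 \<otimes> b x)"
  shows "coslice_sum R (x # w) j (\<lambda>w1 w2. M w1 \<otimes> monomial b w2) =
    coslice_sum R w j (\<lambda>w1 w2. M (x # w1) \<otimes> monomial b w2) \<oplus>
    (case j of 0 \<Rightarrow> \<zero>
     | Suc j' \<Rightarrow> b x \<otimes> coslice_sum R w j' (\<lambda>w1 w2. M w1 \<otimes> monomial b w2))"
proof -
  have sub: "set v \<subseteq> S" if "set v \<subseteq> set (x # w)" for v using that x w by auto
  have sub': "set v \<subseteq> S" if "set v \<subseteq> set w" for v using that w by auto
  have "[((- 1 :: int) ^ (length w - j'))] \<cdot> coslice_sum R w j' (\<lambda>w1 w2. M w1 \<otimes> monomial b (x # w2)) =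
      b x \<otimes> coslice_sum R w j' (\<lambda>w1 w2. M w1 \<otimes> monomial b w2)" for j'
  proof -
    let ?s = "\<lambda>y. [((- 1 :: int) ^ (length w - j'))] \<cdot> y"
    have "coslice_sum R w j' (\<lambda>w1 w2. M w1 \<otimes> monomial b (x # w2)) =
        coslice_sum R w j' (\<lambda>w1 w2. ?s (b x) \<otimes> (M w1 \<otimes> monomial b w2))"
    proof (rule coslice_sum_cong)
      fix w1 w2 assume "set w1 \<subseteq> set w" "set w2 \<subseteq> set w" "length w1 = length w - j'"
      then show "M w1 \<otimes> monomial b (x # w2) = ?s (b x) \<otimes> (M w1 \<otimes> monomial b w2)"
        using comm[of w1] M[of w1] sub' x
        by (auto simp: sign_scale l_minus r_minus simp flip: m_assoc split: if_splits)
    qed (use sub' x M in auto)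
    also have "\<dots> = ?s (b x) \<otimes> coslice_sum R w j' (\<lambda>w1 w2. M w1 \<otimes> monomial b w2)"
      using sub' x M by (intro coslice_sum_mult_left) auto
    finally show ?thesis
      using x coslice_sum_closed[of w "\<lambda>w1 w2. M w1 \<otimes> monomial b w2" j'] M sub'
      by (auto simp: sign_scale l_minus)
  qed
  moreover have "coslice_sum R (x # w) j (\<lambda>w1 w2. M w1 \<otimes> monomial b w2) =
    coslice_sum R w j (\<lambda>w1 w2. M (x # w1) \<otimes> monomial b w2) \<oplus>
    (case j of 0 \<Rightarrow> \<zero>
     | Suc j' \<Rightarrow> [((- 1 :: int) ^ (length w - j'))] \<cdot> coslice_sum R w j' (\<lambda>w1 w2. M w1 \<otimes> monomial b (x # w2)))"
    using sub M by (intro coslice_sum_Cons) auto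
  ultimately show ?thesis by (simp cong: nat.case_cong)
qed

lemma polar_Nil [simp]: "polar [] j = (if j = 0 then \<one> else \<zero>)"
  by (simp add: polar_def coslice_sum_Nil)

text \<open>
  Expansion of the product of the \<open>a x + t b x\<close> along its first factor.
\<close>

lemma polar_Cons:
  assumes "x \<in> S" "set w \<subseteq> S"
  shows "polar (x # w) j = a x \<otimes> polar w j \<oplus> (case j of 0 \<Rightarrow> \<zero> | Suc j' \<Rightarrow> b x \<otimes> polar w j')"
proof -
  have sub: "set v \<subseteq> S" if "set v \<subseteq> set w" for v using that assms by auto
  have "coslice_sum R w j (\<lambda>w1 w2. monomial a (x # w1) \<otimes> monomial b w2) =
      coslice_sum R w j (\<lambda>w1 w2. a x \<otimes> (monomial a w1 \<otimes> monomial b w2))"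
    using sub assms by (intro coslice_sum_cong) (auto simp: m_assoc)
  also have "\<dots> = a x \<otimes> polar w j"
    unfolding polar_def using sub assms by (intro coslice_sum_mult_left) auto
  finally show ?thesis
    unfolding polar_def using assms
    by (subst graded_coslice_sum_Cons) (auto simp: monomial_supercommute)
qed

lemma polar_0: "set w \<subseteq> S \<Longrightarrow> polar w 0 = monomial a w"
  by (induction w) (simp_all add: polar_Cons)

lemma polar_supercommute:
  assumes c: "c \<in> a ` S \<union> b ` S" and "set w \<subseteq> S"
  shows "c \<otimes> polar w j = [((- 1 :: int) ^ length w)] \<cdot> (polar w j \<otimes> c)"
  using assms(2)
proof (induction w arbitrary: j)
  case Nil
  then show ?case using letter_carrier[OF c] by simp
next
  case (Cons x w)
  note carr = letter_carrier[OF c]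
  have *: "c \<otimes> (d \<otimes> polar w j) = [((- 1 :: int) ^ Suc (length w))] \<cdot> ((d \<otimes> polar w j) \<otimes> c)"
    if "d \<in> a ` S \<union> b ` S" for d j
    using that Cons by (intro supercommute_mult c) auto
  show ?case
  proof (cases j)
    case 0
    then show ?thesis using *[of "a x" 0] Cons.prems carr by (simp add: polar_Cons)
  next
    case (Suc j')
    then show ?thesis
      using *[of "a x" j] *[of "b x" j'] Cons.prems carr
      by (simp add: polar_Cons r_distr l_distr add.int_pow_distrib)
  qed
qed

lemma monomial_polar_supercommute:
  assumes "set v \<subseteq> S" "set w \<subseteq> S"
  shows "monomial a v \<otimes> polar w j = [((- 1 :: int) ^ (length v * length w))] \<cdot> (polar w j \<otimes> monomial a v)"
  using assms(1)
proof (induction v)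
  case Nil
  then show ?case using assms by simp
next
  case (Cons x v)
  have "monomial a (x # v) \<otimes> polar w j = a x \<otimes> (monomial a v \<otimes> polar w j)"
    using Cons.prems assms by (simp add: m_assoc)
  also have "\<dots> = [((- 1 :: int) ^ (length v * length w))] \<cdot> ((a x \<otimes> polar w j) \<otimes> monomial a v)"
    using Cons assms by (simp add: add_pow_rdistr_int m_assoc)
  also have "a x \<otimes> polar w j = [((- 1 :: int) ^ length w)] \<cdot> (polar w j \<otimes> a x)"
    using Cons.prems assms by (intro polar_supercommute) auto
  finally show ?case
    using Cons.prems assms by (auto simp: sign_scale l_minus m_assoc)
qed

end

section \<open>Evaluation at opposite parameters\<close>

text \<open>
  If \<open>F i j\<close> is the coefficient of \<open>t\<^sup>i s\<^sup>j\<close> of a polynomial, this is the coefficient of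
  \<open>t\<^sup>r\<close> after the substitution \<open>s = - t\<close>.
\<close>

definition (in ring) alternating_sum :: "nat \<Rightarrow> (nat \<Rightarrow> nat \<Rightarrow> 'a) \<Rightarrow> 'a" where
  "alternating_sum r F = (\<Oplus>j \<in> {..r}. [((- 1 :: int) ^ j)] \<cdot> F (r - j) j)"

context ring
begin

lemma alternating_sum_add:
  assumes "\<And>i j. F i j \<in> carrier R" "\<And>i j. G i j \<in> carrier R"
  shows "alternating_sum r (\<lambda>i j. F i j \<oplus> G i j) = alternating_sum r F \<oplus> alternating_sum r G"
proof -
  have "alternating_sum r (\<lambda>i j. F i j \<oplus> G i j) =
      (\<Oplus>j \<in> {..r}. [((- 1 :: int) ^ j)] \<cdot> F (r - j) j \<oplus> [((- 1 :: int) ^ j)] \<cdot> G (r - j) j)"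
    unfolding alternating_sum_def using assms by (intro finsum_cong') (auto simp: add.int_pow_distrib)
  then show ?thesis
    using assms by (simp add: alternating_sum_def finsum_addf)
qed

lemma alternating_sum_mult_left:
  assumes "\<And>i j. F i j \<in> carrier R" "c \<in> carrier R"
  shows "alternating_sum r (\<lambda>i j. c \<otimes> F i j) = c \<otimes> alternating_sum r F"
  unfolding alternating_sum_def using assms
  by (subst finsum_rdistr) (auto intro!: finsum_cong' add_pow_rdistr_int[symmetric])

lemma alternating_sum_closed [simp]:
  "(\<And>i j. F i j \<in> carrier R) \<Longrightarrow> alternating_sum r F \<in> carrier R"
  unfolding alternating_sum_def by (intro finsum_closed) auto

text \<open>
  The two shift rules say that multiplication by \<open>t\<close> becomes multiplication by \<open>t\<close>, and
  multiplication by \<open>s\<close> becomes multiplication by \<open>- t\<close>.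
\<close>

lemma alternating_sum_shift_left:
  assumes "\<And>i j. H i j \<in> carrier R"
  shows "alternating_sum r (\<lambda>i j. case i of 0 \<Rightarrow> \<zero> | Suc i' \<Rightarrow> H i' j) =
    (case r of 0 \<Rightarrow> \<zero> | Suc r' \<Rightarrow> alternating_sum r' H)"
proof (cases r)
  case 0
  then show ?thesis by (simp add: alternating_sum_def)
next
  case (Suc r')
  have "(\<Oplus>j \<in> {..r'}. [((- 1 :: int) ^ j)] \<cdot> (case Suc r' - j of 0 \<Rightarrow> \<zero> | Suc i' \<Rightarrow> H i' j)) =
      alternating_sum r' H"
    unfolding alternating_sum_def
    by (rule finsum_cong') (auto simp: assms Suc_diff_le)
  then show ?thesis
    using Suc assms unfolding alternating_sum_def
    by (simp add: finsum_Suc Pi_def split: nat.split)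
qed

lemma alternating_sum_shift_right:
  assumes "\<And>i j. H i j \<in> carrier R"
  shows "alternating_sum r (\<lambda>i j. case j of 0 \<Rightarrow> \<zero> | Suc j' \<Rightarrow> H i j') =
    (case r of 0 \<Rightarrow> \<zero> | Suc r' \<Rightarrow> \<ominus> alternating_sum r' H)"
proof (cases r)
  case 0
  then show ?thesis by (simp add: alternating_sum_def)
next
  case (Suc r')
  have "(\<Oplus>j \<in> {..r'}. [((- 1 :: int) ^ Suc j)] \<cdot> H (r' - j) j) =
      (\<Oplus>j \<in> {..r'}. [(- 1 :: int)] \<cdot> ([((- 1 :: int) ^ j)] \<cdot> H (r' - j) j))"
    by (rule finsum_cong') (auto simp: assms sign_scale add.int_pow_neg simp del: power_Suc)
  also have "\<dots> = \<ominus> alternating_sum r' H"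
    unfolding alternating_sum_def
    by (subst finsum_int_pow) (auto simp: assms add.int_pow_neg)
  finally show ?thesis
    using Suc assms unfolding alternating_sum_def
    by (subst Suc, subst finsum_Suc2) (auto simp: Pi_def simp del: power_Suc split: nat.split)
qed

end

context skew_letters
begin

lemma polar2_Nil_Nil: "polar2 [] [] i j = (if i = 0 \<and> j = 0 then \<one> else \<zero>)"
  by (simp add: polar2_def coslice_sum_Nil)

lemma polar2_Cons_left:
  assumes "x \<in> S" "set u \<subseteq> S" "set v \<subseteq> S"
  shows "polar2 (x # u) v i j =
    a x \<otimes> polar2 u v i j \<oplus> (case i of 0 \<Rightarrow> \<zero> | Suc i' \<Rightarrow> b x \<otimes> polar2 u v i' j)"
proof -
  have sub: "set w \<subseteq> S" if "set w \<subseteq> set v" for w using that assms by auto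
  have mult: "coslice_sum R v j (\<lambda>v1 v2. c \<otimes> (polar (u @ v1) i \<otimes> monomial b v2)) = c \<otimes> polar2 u v i j"
    if "c \<in> carrier R" for c i
    unfolding polar2_def using that assms sub by (intro coslice_sum_mult_left) auto
  show ?thesis
  proof (cases i)
    case 0
    have "polar2 (x # u) v i j = coslice_sum R v j (\<lambda>v1 v2. a x \<otimes> (polar (u @ v1) i \<otimes> monomial b v2))"
      unfolding polar2_def using assms sub 0
      by (intro coslice_sum_cong) (auto simp: polar_Cons m_assoc)
    then show ?thesis using 0 mult assms by simp
  next
    case (Suc i')
    have "polar2 (x # u) v i j = coslice_sum R v j (\<lambda>v1 v2.
        a x \<otimes> (polar (u @ v1) i \<otimes> monomial b v2) \<oplus> b x \<otimes> (polar (u @ v1) i' \<otimes> monomial b v2))"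
      unfolding polar2_def using assms sub Suc
      by (intro coslice_sum_cong) (auto simp: polar_Cons m_assoc l_distr)
    also have "\<dots> = a x \<otimes> polar2 u v i j \<oplus> b x \<otimes> polar2 u v i' j"
      using assms sub by (subst coslice_sum_add) (auto simp: mult)
    finally show ?thesis using Suc by simp
  qed
qed

text \<open>
  The new factor is \<open>(a x + t b x) + s b x\<close>, and its first part is what the letter \<open>x\<close> contributes
  when it stands in the first word.
\<close>

lemma polar2_Cons_right:
  assumes "x \<in> S" "set v \<subseteq> S"
  shows "polar2 [] (x # v) i j =
    polar2 [x] v i j \<oplus> (case j of 0 \<Rightarrow> \<zero> | Suc j' \<Rightarrow> b x \<otimes> polar2 [] v i j')"
  using assms unfolding polar2_def
  by (subst graded_coslice_sum_Cons) (auto intro: polar_supercommute)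

text \<open>
  The substitution \<open>s = - t\<close> turns each factor \<open>a x + (t + s) b x\<close> into \<open>a x\<close>, so that only the
  letters of \<open>u\<close> are still polarized.
\<close>

lemma alternating_sum_polar2:
  assumes "set u \<subseteq> S" "set v \<subseteq> S"
  shows "alternating_sum r (polar2 u v) = polar u r \<otimes> monomial a v"
proof -
  have left: "alternating_sum r (polar2 (x # u) v) = a x \<otimes> alternating_sum r (polar2 u v) \<oplus>
      (case r of 0 \<Rightarrow> \<zero> | Suc r' \<Rightarrow> b x \<otimes> alternating_sum r' (polar2 u v))"
    if "x \<in> S" "set u \<subseteq> S" "set v \<subseteq> S" for x u v r
  proof -
    have "polar2 (x # u) v = (\<lambda>i j. a x \<otimes> polar2 u v i j \<oplus>
        (case i of 0 \<Rightarrow> \<zero> | Suc i' \<Rightarrow> b x \<otimes> polar2 u v i' j))"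
      using that by (intro ext polar2_Cons_left)
    then show ?thesis
      using that
      by (simp add: alternating_sum_add alternating_sum_mult_left alternating_sum_shift_left
          split: nat.split)
  qed
  have base: "alternating_sum r (polar2 [] v) = (if r = 0 then monomial a v else \<zero>)"
    if "set v \<subseteq> S" for v r
    using that
  proof (induction v arbitrary: r)
    case Nil
    show ?case
    proof (cases r)
      case (Suc r')
      have "alternating_sum r (polar2 [] []) = (\<Oplus>j \<in> {..r}. \<zero>)"
        unfolding alternating_sum_def using Suc by (intro finsum_cong') (auto simp: polar2_Nil_Nil)
      then show ?thesis using Suc by simp
    qed (simp add: alternating_sum_def polar2_Nil_Nil)
  next
    case (Cons x v)
    have "polar2 [] (x # v) = (\<lambda>i j. polar2 [x] v i j \<oplus>
        (case j of 0 \<Rightarrow> \<zero> | Suc j' \<Rightarrow> b x \<otimes> polar2 [] v i j'))"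
      using Cons.prems by (intro ext polar2_Cons_right) auto
    then have "alternating_sum r (polar2 [] (x # v)) = alternating_sum r (polar2 [x] v) \<oplus>
        (case r of 0 \<Rightarrow> \<zero> | Suc r' \<Rightarrow> \<ominus> (b x \<otimes> alternating_sum r' (polar2 [] v)))"
      using Cons.prems
      by (simp add: alternating_sum_add alternating_sum_mult_left alternating_sum_shift_right
          split: nat.split)
    then show ?case
      using Cons by (auto simp: left r_neg split: nat.split)
  qed
  show ?thesis
    using assms(1)
  proof (induction u arbitrary: r)
    case Nil
    then show ?case using assms by (simp add: base)
  next
    case (Cons x u)
    then show ?case
      using assms by (auto simp: left polar_Cons l_distr m_assoc split: nat.split)
  qed
qed

section \<open>Words with repeated letters\<close>

text \<open>
  The elements \<open>a x + t b x\<close> anticommute.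
\<close>

lemma polar_swap:
  assumes "x \<in> S" "y \<in> S" "set w \<subseteq> S"
  shows "polar (x # y # w) j = \<ominus> polar (y # x # w) j"
proof -
  have swap: "c x \<otimes> (d y \<otimes> polar w j) = \<ominus> (d y \<otimes> (c x \<otimes> polar w j))"
    if "c \<in> {a, b}" "d \<in> {a, b}" for c d j
    using that assms anticommute[of "c x" "d y"] by (auto simp: l_minus simp flip: m_assoc)
  show ?thesis
    using assms swap
    by (auto simp: polar_Cons r_distr minus_add a_ac split: nat.split)
qed

lemma polar_head_repeated:
  assumes "x \<in> set w" "set w \<subseteq> S"
  shows "polar (x # w) j = \<zero>"
  using assms
proof (induction w arbitrary: j)
  case (Cons y w)
  show ?case
  proof (cases "x = y")
    case True
    have sq: "c y \<otimes> (c y \<otimes> polar w j) = \<zero>" if "c \<in> {a, b}" for c j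
      using that Cons.prems True square_zero[of "c y"] by (auto simp flip: m_assoc)
    have ac: "a y \<otimes> (b y \<otimes> polar w j) = \<ominus> (b y \<otimes> (a y \<otimes> polar w j))" for j
      using Cons.prems True anticommute[of "a y" "b y"] by (auto simp: l_minus simp flip: m_assoc)
    show ?thesis
      using Cons.prems sq True
      by (auto simp: polar_Cons r_distr ac l_neg split: nat.split)
  next
    case False
    with Cons have "x \<in> set w" "x \<in> S" "y \<in> S" "set w \<subseteq> S" and "\<And>j. polar (x # w) j = \<zero>"
      by auto
    then have "polar (y # x # w) j = \<zero>"
      by (simp add: polar_Cons[of y] split: nat.split)
    then show ?thesis
      using Cons.prems by (subst polar_swap) auto
  qed
qed simp

text \<open>
  A word with a repeated letter may have an independent set of letters, in which case it
  provides no relation of the Whitney algebra; its polarizations vanish already by skew-symmetry.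
\<close>

lemma polar_not_distinct:
  assumes "\<not> distinct w" "set w \<subseteq> S"
  shows "polar w j = \<zero>"
  using assms
proof (induction w arbitrary: j)
  case (Cons x w)
  then show ?case
    by (cases "x \<in> set w") (auto simp: polar_head_repeated polar_Cons split: nat.split)
qed simp

end

section \<open>Slice sums in an ideal\<close>

lemma (in ring) finsum_in_ideal:
  assumes "ideal I R" "finite A" "\<And>i. i \<in> A \<Longrightarrow> g i \<in> I"
  shows "(\<Oplus>i \<in> A. g i) \<in> I"
proof -
  interpret ideal I R by fact
  from assms(2,3) show ?thesis
  proof (induction A)
    case (insert i A)
    then have "g \<in> A \<rightarrow> carrier R" "g i \<in> carrier R" using a_Hcarr by auto
    with insert show ?case by (simp add: a_closed)
  qed (simp add: zero_closed)
qed

lemma (in ring) sign_scale_in_ideal: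
  assumes "ideal I R" "x \<in> I"
  shows "[((- 1 :: int) ^ n)] \<cdot> x \<in> I"
proof -
  interpret ideal I R by fact
  show ?thesis using assms a_Hcarr a_inv_closed by (simp add: sign_scale)
qed

lemma (in ring) coslice_sum_in_ideal:
  assumes I: "ideal I R"
    and f: "\<And>w1 w2. set w1 \<subseteq> set w \<Longrightarrow> set w2 \<subseteq> set w \<Longrightarrow> length w1 = length w - j \<Longrightarrow> f w1 w2 \<in> I"
  shows "coslice_sum R w j f \<in> I"
proof -
  have len: "length (nths w I) = card I" if "I \<subseteq> {..<length w}" for I
    using that by (auto simp: length_nths intro!: arg_cong[where f = card])
  (* sign is 1 or -1, which are the powers of -1 with exponents 0 and 1 *)
  show ?thesis
    unfolding coslice_sum_def slice_sum_def sign_def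
    by (intro finsum_in_ideal[OF I])
     (auto intro!: f set_nths_subset sign_scale_in_ideal[OF I, of _ 0, simplified]
         sign_scale_in_ideal[OF I, of _ 1, simplified] simp: len)
qed

section \<open>The exchange identity in the Whitney algebra\<close>

lemma free_gen_relation_in_skew_ideal:
  assumes "c \<in> X" "d \<in> X"
  shows "free_gen c \<otimes>\<^bsub>free_algebra X\<^esub> free_gen c \<in> skew_ideal X"
    and "free_gen c \<otimes>\<^bsub>free_algebra X\<^esub> free_gen d \<oplus>\<^bsub>free_algebra X\<^esub>
      free_gen d \<otimes>\<^bsub>free_algebra X\<^esub> free_gen c \<in> skew_ideal X"
proof -
  interpret ring "free_algebra X" by (rule ring_free_algebra)
  let ?G = "{free_gen a \<otimes>\<^bsub>free_algebra X\<^esub> free_gen a | a. a \<in> X} \<union>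
     {free_gen a \<otimes>\<^bsub>free_algebra X\<^esub> free_gen b \<oplus>\<^bsub>free_algebra X\<^esub>
        free_gen b \<otimes>\<^bsub>free_algebra X\<^esub> free_gen a | a b. a \<in> X \<and> b \<in> X}"
  have "?G \<subseteq> carrier (free_algebra X)"
    by (auto simp: free_gen_closed)
  then have sub: "?G \<subseteq> skew_ideal X"
    unfolding skew_ideal_def by (rule genideal_self)
  show "free_gen c \<otimes>\<^bsub>free_algebra X\<^esub> free_gen c \<in> skew_ideal X"
    "free_gen c \<otimes>\<^bsub>free_algebra X\<^esub> free_gen d \<oplus>\<^bsub>free_algebra X\<^esub>
      free_gen d \<otimes>\<^bsub>free_algebra X\<^esub> free_gen c \<in> skew_ideal X"
    by (rule subsetD[OF sub], use assms in blast)+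
qed

lemma skew_letters_Skew: "skew_letters (Skew S) S (\<lambda>x. letter S x 1) (\<lambda>x. letter S x 2)"
proof -
  define X where "X = lp_symbols S"
  define h where "h = (\<lambda>f. skew_ideal X +>\<^bsub>free_algebra X\<^esub> f)"
  interpret F: ring "free_algebra X" by (rule ring_free_algebra)
  interpret I: ideal "skew_ideal X" "free_algebra X" by (rule ideal_skew_ideal)
  interpret R: ring "Skew S" by (rule ring_Skew)
  interpret h: ring_hom_ring "free_algebra X" "Skew S" h
    using I.rcos_ring_hom_ring unfolding h_def Skew_def X_def .
  have zero: "h f = \<zero>\<^bsub>Skew S\<^esub>" if "f \<in> skew_ideal X" for f
    using I.a_rcos_const[OF that] by (simp add: h_def Skew_def FactRing_def X_def)
  have letters: "\<exists>s \<in> X. c = h (free_gen s)"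
    if "c \<in> (\<lambda>x. letter S x 1) ` S \<union> (\<lambda>x. letter S x 2) ` S" for c
    using that by (auto simp: h_def letter_def X_def lp_symbols_def)
  show ?thesis
  proof
    fix c d
    assume c: "c \<in> (\<lambda>x. letter S x 1) ` S \<union> (\<lambda>x. letter S x 2) ` S"
    from letters[OF this] obtain s where s: "s \<in> X" "c = h (free_gen s)" by blast
    note cs = free_gen_closed[OF s(1)]
    show "c \<otimes>\<^bsub>Skew S\<^esub> c = \<zero>\<^bsub>Skew S\<^esub>"
      using zero[OF free_gen_relation_in_skew_ideal(1)[OF s(1) s(1)]] cs s by simp
    assume "d \<in> (\<lambda>x. letter S x 1) ` S \<union> (\<lambda>x. letter S x 2) ` S"
    from letters[OF this] obtain t where t: "t \<in> X" "d = h (free_gen t)" by blast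
    note ct = free_gen_closed[OF t(1)]
    have "c \<otimes>\<^bsub>Skew S\<^esub> d \<oplus>\<^bsub>Skew S\<^esub> d \<otimes>\<^bsub>Skew S\<^esub> c = \<zero>\<^bsub>Skew S\<^esub>"
      using zero[OF free_gen_relation_in_skew_ideal(2)[OF s(1) t(1)]] cs ct s t by simp
    then show "c \<otimes>\<^bsub>Skew S\<^esub> d = \<ominus>\<^bsub>Skew S\<^esub> (d \<otimes>\<^bsub>Skew S\<^esub> c)"
      using cs ct s t by (intro R.minus_equality[symmetric]) auto
  qed (auto simp: letter_closed)
qed

lemma biproduct_in_whitney_ideal:
  assumes "set w \<subseteq> S" "\<not> indep (set w)" "r1 + r2 = length w"
  shows "biproduct S w r1 r2 \<in> whitney_ideal S indep"
proof -
  interpret ring "Skew S" by (rule ring_Skew)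
  let ?G = "{biproduct S w r1 r2 | w r1 r2. set w \<subseteq> S \<and> \<not> indep (set w) \<and> r1 + r2 = length w}"
  have "?G \<subseteq> whitney_ideal S indep"
    unfolding whitney_ideal_def by (rule genideal_self) (auto simp: biproduct_closed)
  then show ?thesis using assms by blast
qed

lemma card_le_matroid_rank:
  assumes "finite X" "I \<subseteq> X" "indep I"
  shows "card I \<le> matroid_rank indep X"
  unfolding matroid_rank_def using assms by (intro Max_ge) auto

text \<open>
  Let \<open>j < k\<close>. In \<open>polar2 u v (k - j) j\<close> every summand contains a polarization of a word
  \<open>u @ v1\<close> of length \<open>p + q - j\<close>. As this exceeds the rank \<open>p + q - k\<close> of \<open>A \<union> B\<close>, the word is
  dependent or has a repeated letter. Hence only the term with \<open>j = k\<close> survives in the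
  alternating sum, and it is the left-hand side up to the sign \<open>(- 1) ^ k\<close>. The remaining sign
  \<open>(- 1) ^ (p * q)\<close> comes from moving the \<open>q\<close> letters of \<open>v\<close> past the \<open>p\<close> letters of \<open>u\<close>.
\<close>

theorem proposition6:
  fixes S :: "'a set" and indep :: "'a set \<Rightarrow> bool"
    and A B :: "'a set" and u v :: "'a list" and p q k :: nat
  assumes "matroid S indep"
    and "indep A" and "distinct u" and "set u = A" and "length u = p"
    and "indep B" and "distinct v" and "set v = B" and "length v = q"
    and "matroid_rank indep (A \<union> B) + k = p + q"
  shows "whitney_class S indep
      (slice_sum (Skew S) v (q - k) k
        (\<lambda>v1 v2. place_word S 1 (u @ v1) \<otimes>\<^bsub>Skew S\<^esub> place_word S 2 v2)) =
    whitney_class S indep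
      ([((- 1 :: int) ^ (p * q + k))] \<cdot>\<^bsub>Skew S\<^esub>
        slice_sum (Skew S) u (p - k) k
          (\<lambda>u1 u2. place_word S 1 (v @ u1) \<otimes>\<^bsub>Skew S\<^esub> place_word S 2 u2))"
proof -
  define a b where "a = (\<lambda>x. letter S x 1)" and "b = (\<lambda>x. letter S x 2)"
  interpret skew_letters "Skew S" S a b
    unfolding a_def b_def by (rule skew_letters_Skew)
  interpret M: matroid S indep by fact
  interpret I: ideal "whitney_ideal S indep" "Skew S" by (rule ideal_whitney_ideal)
  have S: "set u \<subseteq> S" "set v \<subseteq> S"
    using assms M.indep_carrier by auto
  have place: "place_word S 1 w = monomial a w" "place_word S 2 w = monomial b w" for w
    by (simp_all only: place_word_def monomial_def a_def b_def)
  have polar: "polar w j = biproduct S w (length w - j) j" for w j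
    by (simp only: polar_def biproduct_def coslice_sum_def place)
  have lhs: "slice_sum (Skew S) v (q - k) k
      (\<lambda>v1 v2. place_word S 1 (u @ v1) \<otimes>\<^bsub>Skew S\<^esub> place_word S 2 v2) = polar2 u v 0 k"
    unfolding polar2_def coslice_sum_def place \<open>length v = q\<close>
    using S by (intro slice_sum_cong) (auto simp: polar_0)
  have rhs: "slice_sum (Skew S) u (p - k) k
      (\<lambda>u1 u2. place_word S 1 (v @ u1) \<otimes>\<^bsub>Skew S\<^esub> place_word S 2 u2) =
      monomial a v \<otimes>\<^bsub>Skew S\<^esub> polar u k"
  proof -
    have "slice_sum (Skew S) u (p - k) k
        (\<lambda>u1 u2. place_word S 1 (v @ u1) \<otimes>\<^bsub>Skew S\<^esub> place_word S 2 u2) =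
      slice_sum (Skew S) u (p - k) k
        (\<lambda>u1 u2. monomial a v \<otimes>\<^bsub>Skew S\<^esub> (monomial a u1 \<otimes>\<^bsub>Skew S\<^esub> monomial b u2))"
      unfolding place using S by (intro slice_sum_cong) (auto simp: monomial_append m_assoc)
    also have "\<dots> = monomial a v \<otimes>\<^bsub>Skew S\<^esub> polar u k"
      unfolding polar_def coslice_sum_def \<open>length u = p\<close>
      using S by (intro slice_sum_mult_left) auto
    finally show ?thesis .
  qed
  have rank: "p \<le> matroid_rank indep (A \<union> B)"
    using card_le_matroid_rank[of "A \<union> B" A indep] assms distinct_card[of u] by auto
  have vanish: "polar2 u v (k - j) j \<in> whitney_ideal S indep" if "j < k" for j
    unfolding polar2_def
  proof (rule coslice_sum_in_ideal[OF I.ideal_axioms])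
    fix v1 v2 assume v12: "set v1 \<subseteq> set v" "set v2 \<subseteq> set v" and len: "length v1 = length v - j"
    let ?w = "u @ v1"
    have w: "set ?w \<subseteq> S" using S v12 by auto
    have "polar ?w (k - j) \<in> whitney_ideal S indep"
    proof (cases "distinct ?w")
      case False
      then show ?thesis using polar_not_distinct[OF _ w] by (simp add: I.zero_closed)
    next
      case True
      have "j < q" using that rank assms by linarith
      then have "matroid_rank indep (A \<union> B) < length ?w"
        using that len assms by simp
      then have "\<not> indep (set ?w)"
        using card_le_matroid_rank[of "A \<union> B" "set ?w" indep] v12 assms distinct_card[OF True] by auto
      moreover have "k - j \<le> length ?w"
        using \<open>j < q\<close> rank assms len by simp
      ultimately show ?thesis
        unfolding polar using w by (intro biproduct_in_whitney_ideal) auto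
    qed
    then show "polar ?w (k - j) \<otimes>\<^bsub>Skew S\<^esub> monomial b v2 \<in> whitney_ideal S indep"
      using S v12 by (intro I.I_r_closed) auto
  qed
  (* the part of the alternating sum that vanishes in the Whitney algebra *)
  define z where "z = (\<Oplus>\<^bsub>Skew S\<^esub>j \<in> {..<k}. [((- 1 :: int) ^ j)] \<cdot>\<^bsub>Skew S\<^esub> polar2 u v (k - j) j)"
  have z: "z \<in> whitney_ideal S indep"
    unfolding z_def
    by (intro finsum_in_ideal[OF I.ideal_axioms] sign_scale_in_ideal[OF I.ideal_axioms]) (auto simp: vanish)
  have zc: "z \<in> carrier (Skew S)" using z by (rule I.a_Hcarr)
  let ?L = "polar2 u v 0 k" and ?R = "monomial a v \<otimes>\<^bsub>Skew S\<^esub> polar u k"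
  have Lc: "?L \<in> carrier (Skew S)" and Rc: "?R \<in> carrier (Skew S)" using S by auto
  have "[((- 1 :: int) ^ k)] \<cdot>\<^bsub>Skew S\<^esub> ?L \<oplus>\<^bsub>Skew S\<^esub> z = alternating_sum k (polar2 u v)"
    using S finsum_insert[of "{..<k}" k "\<lambda>j. [((- 1 :: int) ^ j)] \<cdot>\<^bsub>Skew S\<^esub> polar2 u v (k - j) j"]
    by (simp add: alternating_sum_def z_def Pi_def flip: lessThan_Suc_atMost lessThan_Suc)
  also have "\<dots> = polar u k \<otimes>\<^bsub>Skew S\<^esub> monomial a v"
    using S by (rule alternating_sum_polar2)
  also have "\<dots> = [((- 1 :: int) ^ (p * q))] \<cdot>\<^bsub>Skew S\<^esub> ?R"
    using monomial_polar_supercommute[OF S(2,1), of k] S assms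
    by (auto simp: sign_scale mult.commute)
  finally have eq: "[((- 1 :: int) ^ k)] \<cdot>\<^bsub>Skew S\<^esub> ?L \<oplus>\<^bsub>Skew S\<^esub> z =
    [((- 1 :: int) ^ (p * q))] \<cdot>\<^bsub>Skew S\<^esub> ?R" .
  have "?L \<oplus>\<^bsub>Skew S\<^esub> [((- 1 :: int) ^ k)] \<cdot>\<^bsub>Skew S\<^esub> z =
      [((- 1 :: int) ^ k)] \<cdot>\<^bsub>Skew S\<^esub> ([((- 1 :: int) ^ k)] \<cdot>\<^bsub>Skew S\<^esub> ?L \<oplus>\<^bsub>Skew S\<^esub> z)"
    using Lc zc by (auto simp: sign_scale minus_add)
  also have "\<dots> = [((- 1 :: int) ^ (p * q + k))] \<cdot>\<^bsub>Skew S\<^esub> ?R"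
    unfolding eq using Rc by (auto simp: sign_scale)
  finally have "[((- 1 :: int) ^ (p * q + k))] \<cdot>\<^bsub>Skew S\<^esub> ?R =
    ?L \<oplus>\<^bsub>Skew S\<^esub> [((- 1 :: int) ^ k)] \<cdot>\<^bsub>Skew S\<^esub> z" by simp
  then have "?L \<ominus>\<^bsub>Skew S\<^esub> [((- 1 :: int) ^ (p * q + k))] \<cdot>\<^bsub>Skew S\<^esub> ?R =
    \<ominus>\<^bsub>Skew S\<^esub> ([((- 1 :: int) ^ k)] \<cdot>\<^bsub>Skew S\<^esub> z)"
    using Lc zc by (simp add: minus_eq minus_add r_neg1 flip: a_assoc) (simp add: r_neg)
  also have "\<dots> \<in> whitney_ideal S indep"
    by (intro I.a_inv_closed sign_scale_in_ideal[OF I.ideal_axioms] z)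
  finally show ?thesis
    unfolding lhs rhs whitney_class_def using Lc Rc
    by (subst quotient_eq_iff_same_a_r_cos[OF I.ideal_axioms, symmetric]) auto
qed

end
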